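(* Let $\mathfrak g$ be a nilpotent Lie algebra with a pseudo-Riemannian metric $g$, let $D$ be a derivation of $\mathfrak g$ and let $\tau=\pm1$. Then the metric $\widetilde g=g+\tau\, e^0\otimes e^0$ on $\widetilde{\mathfrak g}=\mathfrak g\rtimes_D\mathrm{Span}\{e_0\}$ is Einstein if and only if \[\mathrm{Ric}=\tau\Bigl(-\mathrm{tr}\bigl((D^s)^2\bigr)\,\mathrm{Id}-\tfrac12[D,D^*]+(\mathrm{tr}\, D)D^s\Bigr)\quad\text{and}\quad \mathrm{tr}(\mathrm{ad}\,v\circ D^* )=0\ \text{ for all } v\in\mathfrak g;\] in this case, $\widetilde{\mathrm{ric}}=-\tau\,\mathrm{tr}\bigl((D^s)^2\bigr)\,\widetilde g$.
   Context: Lie algebras are real and finite-dimensional. A (pseudo-Riemannian) metric on a Lie algebra is a nondegenerate symmetric bilinear form of any signature; its Ricci tensor $\mathrm{ric}$ and Ricci operator $\mathrm{Ric}$ (defined by $\mathrm{ric}(v,w)=g(\mathrm{Ric}\,v,w)$) are those of the corresponding left-invariant metric on a Lie group with that Lie algebra. Einstein means $\mathrm{ric}=\lambda g$ for a constant $\lambda$. $\mathrm{Ric}$ is the Ricci operator of $(\mathfrak g,g)$ and $\widetilde{\mathrm{ric}}$ is the Ricci tensor of $(\widetilde{\mathfrak g},\widetilde g)$. $D^*$ is the adjoint of $D$ with respect to $g$ and $D^s=\frac12(D+D^* )$. The semidirect product $\mathfrak g\rtimes_D\mathrm{Span}\{e_0\}$ is the vector space $\mathfrak g\oplus\mathrm{Span}\{e_0\}$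 with $\mathfrak g$ as an ideal and $[e_0,x]=Dx$ for $x\in\mathfrak g$. The form $e^0$ satisfies $e^0(e_0)=1$, $e^0|_{\mathfrak g}=0$, and $g$ is extended to $\widetilde{\mathfrak g}$ by zero on $e_0$. *)

theory Defs
  imports "HOL-Analysis.Analysis"
begin

text \<open>
  The underlying real vector space of a Lie algebra is a whole type of class
  \<open>real_vector\<close>; finite-dimensionality is an explicit predicate, so that dimension \<open>0\<close>
  is allowed and no auxiliary inner product or topology is present.
\<close>

definition finite_dim :: "'a::real_vector itself \<Rightarrow> bool" where
  "finite_dim _ \<longleftrightarrow> (\<exists>B :: 'a set. finite B \<and> span B = UNIV)"

text \<open>
  Trace of an endomorphism of a finite-dimensional space: the sum of the diagonal matrix
  entries with respect to a basis. The value does not depend on the basis chosen.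
\<close>

definition lin_trace :: "('a::real_vector \<Rightarrow> 'a) \<Rightarrow> real" where
  "lin_trace f = (let B = (SOME B. independent B \<and> span B = UNIV)
                  in \<Sum>b\<in>B. representation B (f b) b)"

definition lie_algebra :: "('a::real_vector \<Rightarrow> 'a \<Rightarrow> 'a) \<Rightarrow> bool" where
  "lie_algebra br \<longleftrightarrow> bilinear br \<and> (\<forall>x. br x x = 0) \<and>
     (\<forall>x y z. br x (br y z) + br y (br z x) + br z (br x y) = 0)"

primrec lower_central :: "('a::real_vector \<Rightarrow> 'a \<Rightarrow> 'a) \<Rightarrow> nat \<Rightarrow> 'a set" where
  "lower_central br 0 = UNIV"
| "lower_central br (Suc k) = span {br x y | x y. y \<in> lower_central br k}"

definition nilpotent_lie_algebra :: "('a::real_vector \<Rightarrow> 'a \<Rightarrow> 'a) \<Rightarrow> bool" where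
  "nilpotent_lie_algebra br \<longleftrightarrow> lie_algebra br \<and> (\<exists>k. lower_central br k = {0})"

definition derivation :: "('a::real_vector \<Rightarrow> 'a \<Rightarrow> 'a) \<Rightarrow> ('a \<Rightarrow> 'a) \<Rightarrow> bool" where
  "derivation br D \<longleftrightarrow> linear D \<and> (\<forall>x y. D (br x y) = br (D x) y + br x (D y))"

definition pseudo_metric :: "('a::real_vector \<Rightarrow> 'a \<Rightarrow> real) \<Rightarrow> bool" where
  "pseudo_metric g \<longleftrightarrow> bilinear g \<and> (\<forall>x y. g x y = g y x) \<and>
     (\<forall>x. (\<forall>y. g x y = 0) \<longrightarrow> x = 0)"

text \<open>
  The Levi-Civita connection of the left-invariant metric, restricted to left-invariant
  vector fields: the unique bilinear product that is torsion-free and metric. The term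
  \<open>X (g(Y,Z))\<close> of the general metric condition vanishes, because \<open>g(Y,Z)\<close> is
  constant for left-invariant \<open>Y\<close> and \<open>Z\<close>.
\<close>

definition levi_civita ::
    "('a::real_vector \<Rightarrow> 'a \<Rightarrow> 'a) \<Rightarrow> ('a \<Rightarrow> 'a \<Rightarrow> real) \<Rightarrow> 'a \<Rightarrow> 'a \<Rightarrow> 'a" where
  "levi_civita br g = (THE nab. bilinear nab \<and>
     (\<forall>x y. nab x y - nab y x = br x y) \<and>
     (\<forall>x y z. g (nab x y) z + g y (nab x z) = 0))"

definition curvature ::
    "('a::real_vector \<Rightarrow> 'a \<Rightarrow> 'a) \<Rightarrow> ('a \<Rightarrow> 'a \<Rightarrow> real) \<Rightarrow> 'a \<Rightarrow> 'a \<Rightarrow> 'a \<Rightarrow> 'a" where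
  "curvature br g x y z = (let nab = levi_civita br g
     in nab x (nab y z) - nab y (nab x z) - nab (br x y) z)"

text \<open>With these signs, compact groups with a bi-invariant metric have \<open>ric \<ge> 0\<close>.\<close>

definition ricci ::
    "('a::real_vector \<Rightarrow> 'a \<Rightarrow> 'a) \<Rightarrow> ('a \<Rightarrow> 'a \<Rightarrow> real) \<Rightarrow> 'a \<Rightarrow> 'a \<Rightarrow> real" where
  "ricci br g v w = lin_trace (\<lambda>u. curvature br g u v w)"

definition ricci_operator ::
    "('a::real_vector \<Rightarrow> 'a \<Rightarrow> 'a) \<Rightarrow> ('a \<Rightarrow> 'a \<Rightarrow> real) \<Rightarrow> 'a \<Rightarrow> 'a" where
  "ricci_operator br g = (THE A. \<forall>v w. ricci br g v w = g (A v) w)"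

definition einstein ::
    "('a::real_vector \<Rightarrow> 'a \<Rightarrow> 'a) \<Rightarrow> ('a \<Rightarrow> 'a \<Rightarrow> real) \<Rightarrow> bool" where
  "einstein br g \<longleftrightarrow> (\<exists>l. \<forall>v w. ricci br g v w = l * g v w)"

definition metric_adjoint ::
    "('a::real_vector \<Rightarrow> 'a \<Rightarrow> real) \<Rightarrow> ('a \<Rightarrow> 'a) \<Rightarrow> 'a \<Rightarrow> 'a" where
  "metric_adjoint g D = (THE A. \<forall>v w. g (D v) w = g v (A w))"

definition sym_part ::
    "('a::real_vector \<Rightarrow> 'a \<Rightarrow> real) \<Rightarrow> ('a \<Rightarrow> 'a) \<Rightarrow> 'a \<Rightarrow> 'a" where
  "sym_part g D = (\<lambda>v. (1/2) *\<^sub>R (D v + metric_adjoint g D v))"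

text \<open>
  The pair \<open>(x, s)\<close> stands for \<open>x + s e\<^sub>0\<close>; thus \<open>e\<^sub>0 = (0, 1)\<close> and the dual form
  \<open>e\<^sup>0\<close> is \<^const>\<open>snd\<close>.
\<close>

definition semidirect_bracket ::
    "('a::real_vector \<Rightarrow> 'a \<Rightarrow> 'a) \<Rightarrow> ('a \<Rightarrow> 'a) \<Rightarrow> 'a \<times> real \<Rightarrow> 'a \<times> real \<Rightarrow> 'a \<times> real" where
  "semidirect_bracket br D p q =
     (br (fst p) (fst q) + snd p *\<^sub>R D (fst q) - snd q *\<^sub>R D (fst p), 0)"

definition extended_metric ::
    "('a::real_vector \<Rightarrow> 'a \<Rightarrow> real) \<Rightarrow> real \<Rightarrow> 'a \<times> real \<Rightarrow> 'a \<times> real \<Rightarrow> real" where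
  "extended_metric g \<tau> p q = g (fst p) (fst q) + \<tau> * (snd p * snd q)"

end

theory Submission
  imports Defs
begin

text \<open>
  Write \<open>D = S + A\<close> with \<open>S = D\<^sup>s\<close> symmetric and \<open>A\<close> skew for \<open>g\<close>. The Levi-Civita product of the
  extension can be guessed and then verified: for \<open>x, y\<close> in the ideal,

    \<open>x \<cdot> y = \<nabla>\<^sub>x y + \<tau> g(S x, y) e\<^sub>0\<close>,  \<open>x \<cdot> e\<^sub>0 = - S x\<close>,  \<open>e\<^sub>0 \<cdot> x = A x\<close>,  \<open>e\<^sub>0 \<cdot> e\<^sub>0 = 0\<close>,

  where \<open>\<nabla>\<close> is the product of the ideal; \<open>\<tau>\<^sup>2 = 1\<close> makes it metric. Inserting this in the
  curvature and taking traces gives the Ricci tensor of the extension (\<open>ricci_extension\<close>):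

    \<open>ric(v, w) = ric\<^sub>g(v, w) + \<tau> g((1/2) [D, D\<^sup>*] v - (tr D) S v, w)\<close>,
    \<open>ric(v, e\<^sub>0) = - (1/2) tr (ad v \<circ> D\<^sup>*)\<close>,  \<open>ric(e\<^sub>0, e\<^sub>0) = - tr (S\<^sup>2)\<close>,

  with \<open>ric\<^sub>g\<close> the Ricci tensor of the ideal. The theorem is read off from these three blocks: the
  last one forces the Einstein constant to be \<open>- \<tau> tr (S\<^sup>2)\<close>, the middle one has to vanish, and the
  first one is then the equation for the Ricci operator.

  Three facts about traces keep the blocks this short. Traces are cyclic, also for maps between
  two different spaces (\<open>lin_trace_commute\<close>); this contains the independence of the basis, the
  splitting of a trace over a product and the trace of a map of rank one. A map has the same trace
  as its metric adjoint (\<open>lin_trace_adjoint\<close>), so skew maps and products of a skew and a symmetric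
  map have trace zero; in particular this holds for \<open>\<nabla>\<^sub>v\<close> and \<open>\<nabla>\<^sub>v \<circ> S\<close>. A map
  that lowers a finite filtration has trace zero (\<open>lin_trace_filtered_zero\<close>). Nilpotency enters
  only through the last fact: both \<open>ad v\<close> and \<open>D \<circ> ad v\<close> lower the lower central series, because
  a derivation preserves it.
\<close>

section \<open>The trace on finite-dimensional real vector spaces\<close>

lemma finite_dim_obtain_basis:
  assumes "finite_dim TYPE('a::real_vector)"
  obtains B :: "'a::real_vector set" where "finite B" "independent B" "span B = UNIV"
proof -
  obtain C :: "'a set" where C: "finite C" "span C = UNIV"
    using assms by (auto simp: finite_dim_def)
  obtain B where "B \<subseteq> C" "independent B" "C \<subseteq> span B"
    using maximal_independent_subset by blast
  then show ?thesis
    using C that by (metis finite_subset span_mono span_span top.extremum_uniqueI)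
qed

lemma finite_dim_basis_finite:
  assumes "finite_dim TYPE('a::real_vector)" "independent (B :: 'a::real_vector set)"
  shows "finite B"
  using assms independent_span_bound[OF _ assms(2)] unfolding finite_dim_def by auto

text \<open>
  Expanding \<open>f b\<close> in \<open>C\<close> and \<open>h c\<close> in \<open>B\<close> turns both sides into the same double sum. Allowing two
  spaces costs nothing and is what makes the later reductions one-line consequences.
\<close>

lemma basis_trace_commute:
  fixes f :: "'a::real_vector \<Rightarrow> 'b::real_vector" and h :: "'b \<Rightarrow> 'a"
  assumes B: "finite B" "independent B" "span B = UNIV"
    and C: "finite C" "independent C" "span C = UNIV"
    and f: "linear f" and h: "linear h"
  shows "(\<Sum>b\<in>B. representation B (h (f b)) b) = (\<Sum>c\<in>C. representation C (f (h c)) c)"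
proof -
  have 1: "representation B (h (f b)) b
      = (\<Sum>c\<in>C. representation C (f b) c * representation B (h c) b)" for b
  proof -
    have "h (f b) = h (\<Sum>c\<in>C. representation C (f b) c *\<^sub>R c)"
      using sum_representation_eq[of C "f b" C] C by simp
    also have "\<dots> = (\<Sum>c\<in>C. representation C (f b) c *\<^sub>R h c)"
      by (simp add: linear_sum[OF h] linear_scale[OF h])
    finally show ?thesis
      using B by (simp add: representation_sum representation_scale)
  qed
  have 2: "representation C (f (h c)) c
      = (\<Sum>b\<in>B. representation B (h c) b * representation C (f b) c)" for c
  proof -
    have "f (h c) = f (\<Sum>b\<in>B. representation B (h c) b *\<^sub>R b)"
      using sum_representation_eq[of B "h c" B] B by simp
    also have "\<dots> = (\<Sum>b\<in>B. representation B (h c) b *\<^sub>R f b)"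
      by (simp add: linear_sum[OF f] linear_scale[OF f])
    finally show ?thesis
      using C by (simp add: representation_sum representation_scale)
  qed
  show ?thesis
    unfolding 1 2 by (subst sum.swap) (simp add: mult.commute)
qed

text \<open>
  Independence of the basis is cyclicity for the identity, read in two bases.
\<close>

lemma lin_trace_eq_basis:
  fixes f :: "'a::real_vector \<Rightarrow> 'a"
  assumes B: "finite B" "independent B" "span B = UNIV" and f: "linear f"
  shows "lin_trace f = (\<Sum>b\<in>B. representation B (f b) b)"
proof -
  define C :: "'a set" where "C = (SOME C. independent C \<and> span C = UNIV)"
  have C: "independent C \<and> span C = UNIV"
    unfolding C_def
    using someI[of "\<lambda>C :: 'a set. independent C \<and> span C = UNIV" B] B by blast
  moreover have "finite C"
    using finite_dim_basis_finite[of C] B C unfolding finite_dim_def by blast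
  ultimately show ?thesis
    using basis_trace_commute[of C B "\<lambda>x. x" f] B f
    by (simp add: lin_trace_def C_def[symmetric] linear_iff)
qed

lemma lin_trace_commute:
  fixes f :: "'a::real_vector \<Rightarrow> 'b::real_vector" and h :: "'b \<Rightarrow> 'a"
  assumes "finite_dim TYPE('a)" "finite_dim TYPE('b)" and f: "linear f" and h: "linear h"
  shows "lin_trace (\<lambda>x. h (f x)) = lin_trace (\<lambda>y. f (h y))"
proof -
  obtain B :: "'a set" where B: "finite B" "independent B" "span B = UNIV"
    using assms finite_dim_obtain_basis by blast
  obtain C :: "'b set" where C: "finite C" "independent C" "span C = UNIV"
    using assms finite_dim_obtain_basis by blast
  have "linear (\<lambda>x. h (f x))" "linear (\<lambda>y. f (h y))"
    using linear_compose[OF f h] linear_compose[OF h f] by (simp_all add: o_def)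
  then show ?thesis
    by (simp add: lin_trace_eq_basis[OF B] lin_trace_eq_basis[OF C]
        basis_trace_commute[OF B C f h])
qed

lemma lin_trace_add:
  assumes "finite_dim TYPE('a::real_vector)" and f: "linear (f :: 'a::real_vector \<Rightarrow> 'a::real_vector)" and h: "linear h"
  shows "lin_trace (\<lambda>x. f x + h x) = lin_trace f + lin_trace h"
proof -
  obtain B :: "'a set" where B: "finite B" "independent B" "span B = UNIV"
    using assms finite_dim_obtain_basis by blast
  show ?thesis
    unfolding lin_trace_eq_basis[OF B f] lin_trace_eq_basis[OF B h]
      lin_trace_eq_basis[OF B linear_compose_add[OF f h]]
    using B by (simp add: representation_add sum.distrib)
qed

lemma lin_trace_scale:
  assumes "finite_dim TYPE('a::real_vector)" and f: "linear (f :: 'a::real_vector \<Rightarrow> 'a::real_vector)"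
  shows "lin_trace (\<lambda>x. c *\<^sub>R f x) = c * lin_trace f"
proof -
  obtain B :: "'a set" where B: "finite B" "independent B" "span B = UNIV"
    using assms finite_dim_obtain_basis by blast
  show ?thesis
    unfolding lin_trace_eq_basis[OF B f] lin_trace_eq_basis[OF B linear_compose_scale_right[OF f]]
    using B by (simp add: representation_scale sum_distrib_left)
qed

lemma lin_trace_minus:
  assumes "finite_dim TYPE('a::real_vector)" "linear (f :: 'a::real_vector \<Rightarrow> 'a::real_vector)"
  shows "lin_trace (\<lambda>x. - f x) = - lin_trace f"
  using lin_trace_scale[OF assms, of "-1"] by simp

lemma lin_trace_diff:
  assumes "finite_dim TYPE('a::real_vector)" "linear (f :: 'a::real_vector \<Rightarrow> 'a::real_vector)" "linear h"
  shows "lin_trace (\<lambda>x. f x - h x) = lin_trace f - lin_trace h"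
  using lin_trace_add[of f "\<lambda>x. - h x"] lin_trace_minus[of h] assms
  by (simp add: linear_compose_neg)

lemma span_one_real: "span {1 :: real} = UNIV"
  by (simp add: span_singleton)

lemma finite_dim_real: "finite_dim TYPE(real)"
  unfolding finite_dim_def using span_one_real by blast

lemma finite_dim_prod:
  assumes "finite_dim TYPE('a::real_vector)" "finite_dim TYPE('b::real_vector)"
  shows "finite_dim TYPE('a \<times> 'b)"
proof -
  obtain B :: "'a set" and C :: "'b set"
    where B: "finite B" "span B = UNIV" and C: "finite C" "span C = UNIV"
    using assms by (auto simp: finite_dim_def)
  have l: "linear (\<lambda>x::'a. (x, 0::'b))" "linear (\<lambda>y::'b. (0::'a, y))"
    by (auto intro!: linearI)
  let ?E = "(\<lambda>x. (x, 0)) ` B \<union> (\<lambda>y. (0, y)) ` C"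
  have "p \<in> span ?E" for p :: "'a \<times> 'b"
  proof -
    have "(fst p, 0) \<in> span ((\<lambda>x. (x, 0 :: 'b)) ` B)" "(0, snd p) \<in> span ((\<lambda>y. (0 :: 'a, y)) ` C)"
      using B C by (auto simp: linear_span_image[OF l(1)] linear_span_image[OF l(2)])
    then have "(fst p, 0) + (0, snd p) \<in> span ?E"
      by (meson span_add span_mono sup_ge1 sup_ge2 subsetD)
    then show ?thesis by simp
  qed
  then show ?thesis
    unfolding finite_dim_def using B C by (intro exI[of _ ?E]) auto
qed

lemma lin_trace_real:
  assumes "linear (f :: real \<Rightarrow> real)"
  shows "lin_trace f = f 1"
proof -
  have B: "finite {1::real}" "independent {1::real}" "span {1::real} = UNIV"
    by (simp_all add: span_one_real)
  have "representation {1} x (1::real) = x" for x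
    using sum_representation_eq[of "{1}" x "{1}"] B by simp
  then show ?thesis
    by (simp add: lin_trace_eq_basis[OF B assms])
qed

text \<open>
  The map factors through \<open>\<real>\<close> as \<open>\<phi>\<close> followed by multiples of \<open>x\<close>; commuting the factors leaves a
  map of the line.
\<close>

lemma lin_trace_rank_one:
  fixes \<phi> :: "'a::real_vector \<Rightarrow> real"
  assumes "finite_dim TYPE('a)" and l: "linear \<phi>"
  shows "lin_trace (\<lambda>u. \<phi> u *\<^sub>R x) = \<phi> x"
proof -
  have m: "linear (\<lambda>r. r *\<^sub>R x)" by (simp add: linear_iff scaleR_add_left)
  have "lin_trace (\<lambda>r. \<phi> (r *\<^sub>R x)) = \<phi> x"
    using lin_trace_real[of "\<lambda>r. \<phi> (r *\<^sub>R x)"] linear_compose[OF m l] by (simp add: o_def)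
  then show ?thesis
    using lin_trace_commute[OF assms(1) finite_dim_real l m] by simp
qed

text \<open>
  Each diagonal block of \<open>F\<close> arises by cyclicity from the composite of \<open>F\<close> with the projection to
  one factor, followed by the inclusion of that factor.
\<close>

lemma lin_trace_prod_real:
  fixes F :: "'a::real_vector \<times> real \<Rightarrow> 'a \<times> real"
  assumes fin: "finite_dim TYPE('a)" and F: "linear F"
  shows "lin_trace F = lin_trace (\<lambda>u. fst (F (u, 0))) + snd (F (0, 1))"
proof -
  have fin': "finite_dim TYPE('a \<times> real)"
    by (rule finite_dim_prod[OF fin finite_dim_real])
  have i: "linear (\<lambda>x::'a. (x, 0::real))" and j: "linear (\<lambda>y::real. (0::'a, y))"
    by (auto intro!: linearI)
  have f1: "linear (\<lambda>p. fst (F p))" and f2: "linear (\<lambda>p. snd (F p))"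
    using F by (simp_all add: linear_iff)
  have c1: "linear (\<lambda>p. (fst (F p), 0::real))" and c2: "linear (\<lambda>p. (0::'a, snd (F p)))"
    using F by (simp_all add: linear_iff)
  have "lin_trace F = lin_trace (\<lambda>p. (fst (F p), 0) + (0, snd (F p)))" by simp
  also have "\<dots> = lin_trace (\<lambda>p. (fst (F p), 0)) + lin_trace (\<lambda>p. (0, snd (F p)))"
    by (rule lin_trace_add[OF fin' c1 c2])
  also have "lin_trace (\<lambda>p. (fst (F p), 0)) = lin_trace (\<lambda>u. fst (F (u, 0)))"
    by (rule lin_trace_commute[OF fin' fin f1 i])
  also have "lin_trace (\<lambda>p. (0, snd (F p))) = lin_trace (\<lambda>y. snd (F (0, y)))"
    by (rule lin_trace_commute[OF fin' finite_dim_real f2 j])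
  also have "\<dots> = snd (F (0, 1))"
    using linear_compose[OF j f2] by (intro lin_trace_real) (simp add: o_def)
  finally show ?thesis .
qed

text \<open>
  With linear projections \<open>P k\<close> onto \<open>V k\<close>, the map \<open>f \<circ> P k\<close> has its values in \<open>V (Suc k)\<close>, so it
  equals \<open>P (Suc k) \<circ> f \<circ> P k\<close>; cyclicity and \<open>P k \<circ> P (Suc k) = P (Suc k)\<close> show that the trace of
  \<open>f \<circ> P k\<close> does not depend on \<open>k\<close>. It runs from the trace of \<open>f\<close> to zero.
\<close>

lemma lin_trace_filtered_zero:
  fixes f :: "'a::real_vector \<Rightarrow> 'a" and V :: "nat \<Rightarrow> 'a set"
  assumes fin: "finite_dim TYPE('a)" and f: "linear f"
    and V: "V 0 = UNIV" "V n = {0}" "\<And>k. subspace (V k)" "\<And>k. V (Suc k) \<subseteq> V k"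
    and fV: "\<And>k x. x \<in> V k \<Longrightarrow> f x \<in> V (Suc k)"
  shows "lin_trace f = 0"
proof -
  have "\<exists>p. linear p \<and> range p \<subseteq> V k \<and> (\<forall>x\<in>V k. p x = x)" for k
    using linear_exists_left_inverse_on[of "\<lambda>x. x" "V k"] V(3) by (auto simp: linear_iff)
  then obtain P where P: "\<And>k. linear (P k)" "\<And>k x. P k x \<in> V k" "\<And>k x. x \<in> V k \<Longrightarrow> P k x = x"
    by (metis rangeI subsetD)
  have step: "lin_trace (\<lambda>x. f (P k x)) = lin_trace (\<lambda>x. f (P (Suc k) x))" for k
  proof -
    have fP: "linear (\<lambda>x. f (P k x))"
      using linear_compose[OF P(1) f] by (simp add: o_def)
    have "lin_trace (\<lambda>x. f (P k x)) = lin_trace (\<lambda>x. P (Suc k) (f (P k x)))"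
      using fV P(2,3) by simp
    also have "\<dots> = lin_trace (\<lambda>x. f (P k (P (Suc k) x)))"
      by (rule lin_trace_commute[OF fin fin fP P(1)])
    also have "\<dots> = lin_trace (\<lambda>x. f (P (Suc k) x))"
      using P(2,3) V(4) by (metis subsetD)
    finally show ?thesis .
  qed
  have "lin_trace f = lin_trace (\<lambda>x. f (P 0 x))"
    using P(3)[of _ 0] V(1) by simp
  also have "\<dots> = lin_trace (\<lambda>x. f (P n x))"
    using step by (induction n) auto
  also have "\<dots> = lin_trace (\<lambda>x. 0 *\<^sub>R f x)"
    using P(2)[of n] V(2) linear_0[OF f] by simp
  also have "\<dots> = 0"
    unfolding lin_trace_scale[OF fin f] by simp
  finally show ?thesis .
qed

section \<open>Duality with respect to a nondegenerate form\<close>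

lemma linear_injective_surjective:
  fixes f :: "'a::real_vector \<Rightarrow> 'a"
  assumes fin: "finite_dim TYPE('a)" and f: "linear f" "inj f"
  shows "surj f"
proof -
  obtain B :: "'a set" where B: "finite B" "independent B" "span B = UNIV"
    using fin finite_dim_obtain_basis by blast
  interpret finite_dimensional_vector_space "scaleR :: real \<Rightarrow> 'a \<Rightarrow> 'a" B
    using B by unfold_locales (auto simp: dependent_raw_def span_raw_def)
  show ?thesis
    using linear_inj_imp_surj[of f] f by (simp add: linear_def)
qed

lemma pseudo_metricD:
  assumes "pseudo_metric g"
  shows "bilinear g" "g x y = g y x" "\<And>x. (\<And>y. g x y = 0) \<Longrightarrow> x = 0"
    "\<And>x. linear (g x)" "\<And>y. linear (\<lambda>x. g x y)"
  using assms by (auto simp: pseudo_metric_def bilinear_def)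

lemma pseudo_metric_eqI:
  assumes m: "pseudo_metric g" and e: "\<And>z. g x z = g y z"
  shows "x = y"
proof -
  have "x - y = 0"
    using e by (intro pseudo_metricD(3)[OF m]) (simp add: bilinear_lsub[OF pseudo_metricD(1)[OF m]])
  then show ?thesis by simp
qed

text \<open>
  Nondegeneracy says that \<open>x\<close> is determined by the numbers \<open>g x b\<close>, for \<open>b\<close> in a basis. Storing them
  as coordinates gives an injective endomorphism \<open>T\<close>, hence a surjective one, and so
  every list of prescribed values is attained.
\<close>

lemma metric_represents_functional:
  fixes g :: "'a::real_vector \<Rightarrow> 'a \<Rightarrow> real"
  assumes fin: "finite_dim TYPE('a)" and m: "pseudo_metric g" and \<phi>: "linear \<phi>"
  shows "\<exists>x. \<forall>y. \<phi> y = g x y"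
proof -
  obtain B :: "'a set" where B: "finite B" "independent B" "span B = UNIV"
    using fin finite_dim_obtain_basis by blast
  note bg = pseudo_metricD(1)[OF m]
  define T where "T = (\<lambda>x. \<Sum>b\<in>B. g x b *\<^sub>R b)"
  have T: "linear T"
    by (rule linearI)
      (simp_all add: T_def bilinear_ladd[OF bg] bilinear_lmul[OF bg] scaleR_add_left sum.distrib
        scaleR_sum_right)
  have agree: "\<phi> = \<psi>" if "linear \<phi>" "linear \<psi>" "\<And>b. b \<in> B \<Longrightarrow> \<phi> b = \<psi> b" for \<phi> \<psi> :: "'a \<Rightarrow> real"
    using linear_eq_on[OF that(1,2), of _ B] that(3) B by auto
  have coords: "u b = w b" if "(\<Sum>b\<in>B. u b *\<^sub>R b) = (\<Sum>b\<in>B. w b *\<^sub>R b)" "b \<in> B" for u w b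
    using independentD[of B B "\<lambda>b. u b - w b" b] that B
    by (simp add: scaleR_diff_left sum_subtractf)
  have "inj T"
  proof (rule injI)
    fix x y assume "T x = T y"
    then have "g x b = g y b" if "b \<in> B" for b
      using coords[OF _ that, of "g x" "g y"] by (simp add: T_def)
    then have "g x = g y"
      using pseudo_metricD(4)[OF m] by (intro agree)
    then show "x = y"
      using pseudo_metric_eqI[OF m] by metis
  qed
  then have "surj T" by (rule linear_injective_surjective[OF fin T])
  then obtain x where "T x = (\<Sum>b\<in>B. \<phi> b *\<^sub>R b)" by (metis surjD)
  then have "\<phi> b = g x b" if "b \<in> B" for b
    using coords[OF _ that, of \<phi> "g x"] by (simp add: T_def)
  then have "\<phi> = g x"
    using pseudo_metricD(4)[OF m] \<phi> by (intro agree)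
  then show ?thesis by auto
qed

text \<open>
  The choice of the representing vectors for a whole family of functionals: it is used for
  adjoints, for the Koszul formula, for the Ricci operator and for dual bases.
\<close>

lemma metric_represents_form:
  fixes g :: "'a::real_vector \<Rightarrow> 'a \<Rightarrow> real"
  assumes fin: "finite_dim TYPE('a)" and m: "pseudo_metric g" and h: "\<And>i. linear (h i)"
  shows "\<exists>F. \<forall>i v. h i v = g (F i) v"
  using metric_represents_functional[OF fin m h] by metis

lemma metric_adjoint_properties:
  assumes "finite_dim TYPE('a::real_vector)" and m: "pseudo_metric (g :: 'a::real_vector \<Rightarrow> 'a::real_vector \<Rightarrow> real)" and D: "linear D"
  shows "g (D v) w = g v (metric_adjoint g D w)" "linear (metric_adjoint g D)"
proof -
  note bg = pseudo_metricD(1)[OF m]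
  have "linear (\<lambda>v. g (D v) w)" for w
    using linear_compose[OF D pseudo_metricD(5)[OF m]] by (simp add: o_def)
  then obtain F where F: "\<And>w v. g (D v) w = g (F w) v"
    using metric_represents_form[OF assms(1) m, of "\<lambda>w v. g (D v) w"] by blast
  have "metric_adjoint g D = F"
    unfolding metric_adjoint_def
  proof (rule the_equality)
    show "\<forall>v w. g (D v) w = g v (F w)"
      using F pseudo_metricD(2)[OF m] by metis
  next
    fix A assume "\<forall>v w. g (D v) w = g v (A w)"
    then show "A = F"
      using F pseudo_metricD(2)[OF m] by (intro ext pseudo_metric_eqI[OF m]) metis
  qed
  then show adj: "g (D v) w = g v (metric_adjoint g D w)" for v w
    using F pseudo_metricD(2)[OF m] by metis
  show "linear (metric_adjoint g D)"
  proof (rule linearI)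
    show "metric_adjoint g D (x + y) = metric_adjoint g D x + metric_adjoint g D y" for x y
      by (rule pseudo_metric_eqI[OF m])
        (simp add: bilinear_ladd[OF bg] pseudo_metricD(2)[OF m, of _ "_ :: 'a"]
          bilinear_radd[OF bg] flip: adj)
    show "metric_adjoint g D (c *\<^sub>R x) = c *\<^sub>R metric_adjoint g D x" for c x
      by (rule pseudo_metric_eqI[OF m])
        (metis adj bg bilinear_rmul pseudo_metricD(2)[OF m])
  qed
qed

text \<open>
  Let \<open>d\<close> be the \<open>g\<close>-dual of a basis \<open>B\<close>, so that \<open>g (d b)\<close> is the coordinate along \<open>b\<close>. The vectors
  \<open>d b\<close> also span, with coordinates \<open>g v b\<close>, and the trace of \<open>f\<close> becomes the double sum of
  \<open>g (f c) b * g (d c) (d b)\<close>, which is symmetric under exchanging \<open>f\<close> with its adjoint.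
\<close>

lemma lin_trace_adjoint:
  fixes g :: "'a::real_vector \<Rightarrow> 'a \<Rightarrow> real"
  assumes fin: "finite_dim TYPE('a)" and m: "pseudo_metric g"
    and f: "linear f" and h: "linear h" and adj: "\<And>v w. g (f v) w = g v (h w)"
  shows "lin_trace f = lin_trace h"
proof -
  obtain B :: "'a set" where B: "finite B" "independent B" "span B = UNIV"
    using fin finite_dim_obtain_basis by blast
  note bg = pseudo_metricD(1)[OF m] and sym = pseudo_metricD(2)[OF m]
  have "linear (\<lambda>v. representation B v b)" for b
    using B by (simp add: linear_iff representation_add representation_scale)
  then obtain d where d: "\<And>b v. representation B v b = g (d b) v"
    using metric_represents_form[OF fin m, of "\<lambda>b v. representation B v b"] by blast
  have expand: "v = (\<Sum>b\<in>B. g v b *\<^sub>R d b)" for v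
  proof (rule pseudo_metric_eqI[OF m])
    fix w
    have "g v w = g v (\<Sum>b\<in>B. g (d b) w *\<^sub>R b)"
      using sum_representation_eq[of B w B] B by (simp add: d)
    also have "\<dots> = (\<Sum>b\<in>B. g v b * g (d b) w)"
      by (simp add: linear_sum[OF pseudo_metricD(4)[OF m]] bilinear_rmul[OF bg] mult.commute)
    also have "\<dots> = g (\<Sum>b\<in>B. g v b *\<^sub>R d b) w"
      by (simp add: linear_sum[OF pseudo_metricD(5)[OF m]] bilinear_lmul[OF bg])
    finally show "g v w = g (\<Sum>b\<in>B. g v b *\<^sub>R d b) w" .
  qed
  have pair: "g x y = (\<Sum>b\<in>B. g y b * g x (d b))" for x y
  proof -
    have "g x y = g x (\<Sum>b\<in>B. g y b *\<^sub>R d b)"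
      by (rule arg_cong[OF expand])
    then show ?thesis
      by (simp add: linear_sum[OF pseudo_metricD(4)[OF m]] bilinear_rmul[OF bg])
  qed
  have "lin_trace f = (\<Sum>c\<in>B. g (d c) (f c))"
    by (simp add: lin_trace_eq_basis[OF B f] d)
  also have "\<dots> = (\<Sum>c\<in>B. \<Sum>b\<in>B. g (f c) b * g (d c) (d b))"
    by (intro sum.cong refl pair)
  also have "\<dots> = (\<Sum>c\<in>B. \<Sum>b\<in>B. g c (h b) * g (d b) (d c))"
    by (simp add: adj sym[of "d _" "d _"])
  also have "\<dots> = (\<Sum>b\<in>B. \<Sum>c\<in>B. g (h b) c * g (d b) (d c))"
    by (subst sum.swap) (simp add: sym[of _ "h _"])
  also have "\<dots> = (\<Sum>b\<in>B. g (d b) (h b))"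
    by (intro sum.cong refl pair[symmetric])
  also have "\<dots> = lin_trace h"
    by (simp add: lin_trace_eq_basis[OF B h] d)
  finally show ?thesis .
qed

lemma lin_trace_skew_zero:
  assumes "finite_dim TYPE('a::real_vector)" "pseudo_metric (g :: 'a::real_vector \<Rightarrow> 'a::real_vector \<Rightarrow> real)"
    and f: "linear f" "\<And>v w. g (f v) w = - g v (f w)"
  shows "lin_trace f = 0"
proof -
  have "lin_trace f = lin_trace (\<lambda>x. - f x)"
    using assms by (intro lin_trace_adjoint[of g])
      (auto simp: linear_compose_neg bilinear_rneg[OF pseudo_metricD(1)])
  then show ?thesis
    using lin_trace_minus[OF assms(1) f(1)] by simp
qed

lemma lin_trace_skew_symmetric_zero:
  assumes fin: "finite_dim TYPE('a::real_vector)" and m: "pseudo_metric (g :: 'a::real_vector \<Rightarrow> 'a::real_vector \<Rightarrow> real)"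
    and f: "linear f" "\<And>v w. g (f v) w = - g v (f w)"
    and s: "linear s" "\<And>v w. g (s v) w = g v (s w)"
  shows "lin_trace (\<lambda>x. f (s x)) = 0"
proof -
  have l: "linear (\<lambda>x. s (f x))" "linear (\<lambda>x. f (s x))"
    using linear_compose[OF f(1) s(1)] linear_compose[OF s(1) f(1)] by (simp_all add: o_def)
  have "lin_trace (\<lambda>x. f (s x)) = lin_trace (\<lambda>x. - s (f x))"
    using l f s by (intro lin_trace_adjoint[OF fin m])
      (auto simp: linear_compose_neg bilinear_rneg[OF pseudo_metricD(1)[OF m]])
  also have "\<dots> = - lin_trace (\<lambda>x. s (f x))"
    by (rule lin_trace_minus[OF fin l(1)])
  also have "lin_trace (\<lambda>x. s (f x)) = lin_trace (\<lambda>x. f (s x))"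
    by (rule lin_trace_commute[OF fin fin f(1) s(1)])
  finally show ?thesis by simp
qed

section \<open>Levi-Civita product and Ricci tensor\<close>

text \<open>
  Summing the metric condition over the cyclic permutations of \<open>x, y, z\<close> with signs leaves, up to
  torsion, only \<open>g (nab x y) z\<close>; so the product is unique.
\<close>

lemma koszul_formula:
  assumes m: "pseudo_metric g"
    and torsion: "\<And>x y. nab x y - nab y x = br x y"
    and metric: "\<And>x y z. g (nab x y) z + g y (nab x z) = 0"
  shows "2 * g (nab x y) z = g (br x y) z - g (br y z) x + g (br z x) y"
proof -
  note bg = pseudo_metricD(1)[OF m] and sym = pseudo_metricD(2)[OF m]
  have "g (br x y) z = g (nab x y) z - g (nab y x) z" for x y z
    by (simp add: torsion[symmetric] bilinear_lsub[OF bg])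
  then show ?thesis
    using metric[of x y z] metric[of y z x] metric[of z x y]
    by (simp add: sym[of y] sym[of z] sym[of x])
qed

lemma levi_civita_eqI:
  assumes m: "pseudo_metric g" and b: "bilinear nab"
    and torsion: "\<And>x y. nab x y - nab y x = br x y"
    and metric: "\<And>x y z. g (nab x y) z + g y (nab x z) = 0"
  shows "levi_civita br g = nab"
  unfolding levi_civita_def
proof (rule the_equality)
  fix nab'
  assume *: "bilinear nab' \<and> (\<forall>x y. nab' x y - nab' y x = br x y) \<and>
    (\<forall>x y z. g (nab' x y) z + g y (nab' x z) = 0)"
  have "g (nab' x y) z = g (nab x y) z" for x y z
    using koszul_formula[OF m, of nab br, OF torsion metric, of x y z]
      koszul_formula[OF m, of nab' br x y z] * by simp
  then show "nab' = nab"
    by (intro ext pseudo_metric_eqI[OF m])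
qed (use assms in auto)

text \<open>
  Existence: the Koszul formula defines \<open>\<nabla>\<^sub>x y\<close> through the functional \<open>K x y\<close>, and the
  three properties become identities for \<open>K\<close>, by the antisymmetry of the bracket and the symmetry of
  the metric.
\<close>

lemma levi_civita_properties:
  fixes g :: "'a::real_vector \<Rightarrow> 'a \<Rightarrow> real"
  assumes fin: "finite_dim TYPE('a)" and m: "pseudo_metric g"
    and br: "bilinear br" "\<And>x y. br y x = - br x y"
  shows "bilinear (levi_civita br g)"
    "levi_civita br g x y - levi_civita br g y x = br x y"
    "g (levi_civita br g x y) z = - g y (levi_civita br g x z)"
proof -
  note bg = pseudo_metricD(1)[OF m] and sym = pseudo_metricD(2)[OF m]
  note lin = bilinear_ladd[OF bg] bilinear_radd[OF bg] bilinear_lmul[OF bg] bilinear_rmul[OF bg]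
    bilinear_lsub[OF bg] bilinear_lneg[OF bg] bilinear_rneg[OF bg]
    bilinear_ladd[OF br(1)] bilinear_radd[OF br(1)] bilinear_lmul[OF br(1)] bilinear_rmul[OF br(1)]
  define K where "K x y z = (g (br x y) z - g (br y z) x + g (br z x) y) / 2" for x y z
  have "linear (K (fst p) (snd p))" for p
    unfolding K_def by (rule linearI) (simp_all add: lin field_simps)
  then obtain F where F: "\<And>p z. K (fst p) (snd p) z = g (F p) z"
    using metric_represents_form[OF fin m, of "\<lambda>p. K (fst p) (snd p)"] by blast
  define nab where "nab x y = F (x, y)" for x y
  have nab: "g (nab x y) z = K x y z" for x y z
    by (simp add: nab_def flip: F)
  have b: "bilinear nab"
    unfolding bilinear_def
    by (intro conjI allI linearI; rule pseudo_metric_eqI[OF m])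
      (simp_all add: lin nab K_def field_simps)
  have t: "nab x y - nab y x = br x y" for x y
  proof (rule pseudo_metric_eqI[OF m])
    fix z
    show "g (nab x y - nab y x) z = g (br x y) z"
      by (simp add: lin nab K_def br(2)[of x y] br(2)[of y z] br(2)[of x z] field_simps)
  qed
  have c: "g (nab x y) z + g y (nab x z) = 0" for x y z
    by (simp add: sym[of y "nab x z"] lin nab K_def br(2)[of x y] br(2)[of y z] br(2)[of x z]
        field_simps)
  have "levi_civita br g = nab"
    by (rule levi_civita_eqI[of g nab br]) (fact m b t c)+
  then show "bilinear (levi_civita br g)"
    "levi_civita br g x y - levi_civita br g y x = br x y"
    "g (levi_civita br g x y) z = - g y (levi_civita br g x z)"
    using b t c by (auto simp: eq_neg_iff_add_eq_0)
qed

text \<open>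
  The Ricci tensor is linear in its second argument, hence represented by \<open>g\<close>; this makes the
  description that defines the Ricci operator a genuine characterisation.
\<close>

lemma ricci_operator_eq_iff:
  fixes g :: "'a::real_vector \<Rightarrow> 'a \<Rightarrow> real"
  assumes fin: "finite_dim TYPE('a)" and m: "pseudo_metric g"
    and br: "bilinear br" "\<And>x y. br y x = - br x y"
  shows "ricci_operator br g = F \<longleftrightarrow> (\<forall>v w. ricci br g v w = g (F v) w)"
proof -
  note bn = levi_civita_properties(1)[OF fin m br]
  note lin = bilinear_ladd[OF bn] bilinear_radd[OF bn] bilinear_lmul[OF bn] bilinear_rmul[OF bn]
    bilinear_ladd[OF br(1)] bilinear_radd[OF br(1)] bilinear_lmul[OF br(1)] bilinear_rmul[OF br(1)]
  have u: "linear (\<lambda>u. curvature br g u v w)" for v w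
    by (rule linearI) (simp_all add: curvature_def Let_def lin algebra_simps)
  have w: "linear (\<lambda>w. curvature br g u v w)" for u v
    by (rule linearI) (simp_all add: curvature_def Let_def lin algebra_simps)
  have "linear (ricci br g v)" for v
    by (rule linearI)
      (simp_all add: ricci_def linear_add[OF w] linear_scale[OF w] lin_trace_add[OF fin u u]
        lin_trace_scale[OF fin u])
  then obtain R where R: "\<And>v w. ricci br g v w = g (R v) w"
    using metric_represents_form[OF fin m, of "ricci br g"] by blast
  have "ricci_operator br g = R"
    unfolding ricci_operator_def
    by (rule the_equality) (use R in \<open>auto intro!: ext pseudo_metric_eqI[OF m]\<close>)
  then show ?thesis
    using R by (auto intro!: ext pseudo_metric_eqI[OF m])
qed

section \<open>Trace vanishing from nilpotency\<close>

lemma lower_central_subspace: "subspace (lower_central br k)"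
  by (cases k) (auto simp: subspace_UNIV)

lemma lower_central_decreasing: "lower_central br (Suc k) \<subseteq> lower_central br k"
proof (induction k)
  case (Suc k)
  then show ?case
    by (simp only: lower_central.simps) (intro span_mono, blast)
qed simp

lemma derivation_preserves_lower_central:
  assumes "derivation br D" "x \<in> lower_central br k"
  shows "D x \<in> lower_central br k"
  using assms(2)
proof (induction k arbitrary: x)
  case (Suc k)
  have D: "linear D" "\<And>x y. D (br x y) = br (D x) y + br x (D y)"
    using assms(1) by (auto simp: derivation_def)
  let ?G = "{br x y | x y. y \<in> lower_central br k}"
  have "D ` ?G \<subseteq> span ?G"
  proof clarify
    fix x y assume "y \<in> lower_central br k"
    then have "br (D x) y \<in> ?G" "br x (D y) \<in> ?G" using Suc.IH by blast+
    then show "D (br x y) \<in> span ?G"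
      unfolding D(2) by (intro span_add span_base)
  qed
  then have "D ` span ?G \<subseteq> span ?G"
    unfolding linear_span_image[OF D(1), symmetric] by (rule span_minimal) (rule subspace_span)
  then show ?case using Suc.prems by auto
qed simp

text \<open>
  The map \<open>E \<circ> ad v\<close> lowers the lower central series by one step; the cases needed are the identity and
  a derivation for \<open>E\<close>.
\<close>

lemma nilpotent_trace_zero:
  fixes br :: "'a::real_vector \<Rightarrow> 'a \<Rightarrow> 'a"
  assumes fin: "finite_dim TYPE('a)" and nil: "nilpotent_lie_algebra br"
    and E: "linear E" "\<And>k x. x \<in> lower_central br k \<Longrightarrow> E x \<in> lower_central br k"
  shows "lin_trace (\<lambda>u. E (br v u)) = 0"
proof -
  have b: "bilinear br" using nil by (simp add: nilpotent_lie_algebra_def lie_algebra_def)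
  obtain n where n: "lower_central br n = {0}"
    using nil by (auto simp: nilpotent_lie_algebra_def)
  show ?thesis
  proof (rule lin_trace_filtered_zero[OF fin, of _ "lower_central br" n])
    show "linear (\<lambda>u. E (br v u))"
      using E(1) b linear_compose[of "br v" E] by (simp add: o_def bilinear_def)
    fix k x assume "x \<in> lower_central br k"
    then have "br v x \<in> lower_central br (Suc k)"
      by (auto intro: span_base)
    then show "E (br v x) \<in> lower_central br (Suc k)" by (rule E(2))
  qed (simp_all only: n lower_central_subspace lower_central_decreasing lower_central.simps(1))
qed

section \<open>The extension by a derivation\<close>

lemma pseudo_metric_extended:
  assumes m: "pseudo_metric g" and "\<tau> \<noteq> 0"
  shows "pseudo_metric (extended_metric g \<tau>)"
proof -
  note bg = pseudo_metricD(1)[OF m]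
  note lin = bilinear_ladd[OF bg] bilinear_radd[OF bg] bilinear_lmul[OF bg] bilinear_rmul[OF bg]
  have "p = 0" if p: "\<And>q. extended_metric g \<tau> p q = 0" for p
  proof -
    have "g (fst p) y = 0" for y
      using p[of "(y, 0)"] by (simp add: extended_metric_def)
    moreover have "snd p = 0"
      using p[of "(0, 1)"] assms by (simp add: extended_metric_def bilinear_rzero[OF bg])
    ultimately show ?thesis
      using pseudo_metricD(3)[OF m] by (simp add: prod_eq_iff)
  qed
  moreover have "bilinear (extended_metric g \<tau>)"
    unfolding bilinear_def
    by (intro conjI allI linearI) (simp_all add: extended_metric_def lin algebra_simps)
  moreover have "extended_metric g \<tau> p q = extended_metric g \<tau> q p" for p q
    by (simp add: extended_metric_def pseudo_metricD(2)[OF m, of "fst p"])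
  ultimately show ?thesis
    unfolding pseudo_metric_def by blast
qed

locale derivation_extension =
  fixes br :: "'a::real_vector \<Rightarrow> 'a \<Rightarrow> 'a"
    and g :: "'a \<Rightarrow> 'a \<Rightarrow> real"
    and D :: "'a \<Rightarrow> 'a"
    and \<tau> :: real
  assumes fin: "finite_dim TYPE('a)"
    and nil: "nilpotent_lie_algebra br"
    and met: "pseudo_metric g"
    and der: "derivation br D"
    and tau: "\<tau> * \<tau> = 1"
begin

abbreviation nab where "nab \<equiv> levi_civita br g"
abbreviation Dt where "Dt \<equiv> metric_adjoint g D"
abbreviation S where "S \<equiv> sym_part g D"
definition A where "A v = (1/2) *\<^sub>R (D v - Dt v)"

lemma bracket: "bilinear br" "br y x = - br x y"
proof -
  show b: "bilinear br" using nil by (simp add: nilpotent_lie_algebra_def lie_algebra_def)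
  have "br (x + y) (x + y) = 0" "br x x = 0" "br y y = 0"
    using nil by (auto simp: nilpotent_lie_algebra_def lie_algebra_def)
  then show "br y x = - br x y"
    by (simp add: bilinear_ladd[OF b] bilinear_radd[OF b] eq_neg_iff_add_eq_0 add.commute)
qed

lemmas nab = levi_civita_properties[OF fin met bracket]

lemma linear_D: "linear D"
  using der by (simp add: derivation_def)

lemmas Dt = metric_adjoint_properties[OF fin met linear_D]

lemma linear_S: "linear S" and linear_A: "linear A"
  by (auto intro!: linearI simp: sym_part_def A_def linear_add[OF linear_D] linear_add[OF Dt(2)]
      linear_scale[OF linear_D] linear_scale[OF Dt(2)] algebra_simps)

lemma D_split: "D v = S v + A v" and Dt_split: "Dt v = S v - A v"
proof -
  have "S v + A v = (1/2) *\<^sub>R ((D v + Dt v) + (D v - Dt v))"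
    unfolding sym_part_def A_def by (simp only: scaleR_add_right)
  also have "(D v + Dt v) + (D v - Dt v) = 2 *\<^sub>R D v"
    unfolding scaleR_2 by simp
  finally show "D v = S v + A v" by simp
  have "S v - A v = (1/2) *\<^sub>R ((D v + Dt v) - (D v - Dt v))"
    unfolding sym_part_def A_def by (simp only: scaleR_diff_right)
  also have "(D v + Dt v) - (D v - Dt v) = 2 *\<^sub>R Dt v"
    unfolding scaleR_2 by simp
  finally show "Dt v = S v - A v" by simp
qed

text \<open>
  The skew part and the symmetric part enter the Ricci tensor through their commutator, while the
  statement of the theorem speaks of \<open>D\<close> and its adjoint.
\<close>

lemma commutator_A_S: "A (S v) - S (A v) = (1/2) *\<^sub>R (D (Dt v) - Dt (D v))"
proof -
  have DDt: "D (Dt v) = S (S v) - S (A v) + (A (S v) - A (A v))"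
    using D_split[of "Dt v"] by (simp add: Dt_split linear_diff[OF linear_S] linear_diff[OF linear_A])
  have DtD: "Dt (D v) = S (S v) + S (A v) - (A (S v) + A (A v))"
    using Dt_split[of "D v"] by (simp add: D_split linear_add[OF linear_S] linear_add[OF linear_A])
  have "D (Dt v) - Dt (D v) = 2 *\<^sub>R (A (S v) - S (A v))"
    unfolding DDt DtD scaleR_2 by simp
  then show ?thesis by simp
qed

lemmas lin = bilinear_ladd[OF pseudo_metricD(1)[OF met]] bilinear_radd[OF pseudo_metricD(1)[OF met]]
  bilinear_lmul[OF pseudo_metricD(1)[OF met]] bilinear_rmul[OF pseudo_metricD(1)[OF met]]
  bilinear_lsub[OF pseudo_metricD(1)[OF met]] bilinear_rsub[OF pseudo_metricD(1)[OF met]]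
  bilinear_lneg[OF pseudo_metricD(1)[OF met]] bilinear_rneg[OF pseudo_metricD(1)[OF met]]
  bilinear_lzero[OF pseudo_metricD(1)[OF met]] bilinear_rzero[OF pseudo_metricD(1)[OF met]]
  bilinear_ladd[OF bracket(1)] bilinear_radd[OF bracket(1)]
  bilinear_lmul[OF bracket(1)] bilinear_rmul[OF bracket(1)]
  bilinear_lsub[OF bracket(1)] bilinear_rsub[OF bracket(1)]
  bilinear_lneg[OF bracket(1)] bilinear_rneg[OF bracket(1)]
  bilinear_lzero[OF bracket(1)] bilinear_rzero[OF bracket(1)]
  bilinear_ladd[OF nab(1)] bilinear_radd[OF nab(1)] bilinear_lmul[OF nab(1)] bilinear_rmul[OF nab(1)]
  bilinear_lsub[OF nab(1)] bilinear_rsub[OF nab(1)] bilinear_lneg[OF nab(1)] bilinear_rneg[OF nab(1)]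
  bilinear_lzero[OF nab(1)] bilinear_rzero[OF nab(1)]
  linear_add[OF linear_S] linear_add[OF linear_A] linear_scale[OF linear_S] linear_scale[OF linear_A]
  linear_diff[OF linear_S] linear_diff[OF linear_A] linear_neg[OF linear_S] linear_neg[OF linear_A]
  linear_0[OF linear_S] linear_0[OF linear_A]
  linear_add[OF linear_D] linear_scale[OF linear_D] linear_0[OF linear_D]

lemma S_symmetric: "g (S v) w = g v (S w)" and A_skew: "g (A v) w = - g v (A w)"
proof -
  have "g (Dt v) w = g v (D w)" for v w
    using Dt(1)[of w v] by (simp add: pseudo_metricD(2)[OF met])
  then show "g (S v) w = g v (S w)" "g (A v) w = - g v (A w)"
    by (simp_all add: sym_part_def A_def lin Dt(1) field_simps)
qed

lemma trace_S: "lin_trace S = lin_trace D"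
proof -
  have "lin_trace D = lin_trace (\<lambda>v. S v + A v)"
    by (rule arg_cong[of _ _ lin_trace]) (simp add: fun_eq_iff flip: D_split)
  also have "\<dots> = lin_trace S + lin_trace A"
    by (rule lin_trace_add[OF fin linear_S linear_A])
  also have "lin_trace A = 0"
    by (rule lin_trace_skew_zero[OF fin met linear_A]) (rule A_skew)
  finally show ?thesis by simp
qed

text \<open>
  The solution of the Koszul formula on the extension. Up to sign, \<open>S\<close> is the shape
  operator of the ideal; torsion-freeness leaves \<open>D - S = A\<close> for the derivative along \<open>e\<^sub>0\<close>, and
  this has to be skew, which singles out the symmetric part.
\<close>

definition ext_nab :: "'a \<times> real \<Rightarrow> 'a \<times> real \<Rightarrow> 'a \<times> real" where
  "ext_nab p q = (nab (fst p) (fst q) + snd p *\<^sub>R A (fst q) - snd q *\<^sub>R S (fst p),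
     \<tau> * g (S (fst p)) (fst q))"

lemma levi_civita_extension:
  "levi_civita (semidirect_bracket br D) (extended_metric g \<tau>) = ext_nab"
proof (rule levi_civita_eqI)
  show "pseudo_metric (extended_metric g \<tau>)"
    by (rule pseudo_metric_extended[OF met]) (use tau in auto)
  show "bilinear ext_nab"
    unfolding bilinear_def
    by (intro conjI allI linearI) (simp_all add: ext_nab_def lin algebra_simps)
  show "ext_nab p q - ext_nab q p = semidirect_bracket br D p q" for p q
  proof -
    have "g (S (fst p)) (fst q) = g (S (fst q)) (fst p)"
      by (metis S_symmetric pseudo_metricD(2)[OF met])
    then show ?thesis
      using nab(2)[of "fst p" "fst q"]
      by (simp add: ext_nab_def semidirect_bracket_def D_split scaleR_add_right algebra_simps)
  qed
  show "extended_metric g \<tau> (ext_nab p q) r + extended_metric g \<tau> q (ext_nab p r) = 0" for p q r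
  proof -
    have square: "\<tau> * (\<tau> * x) = x" for x
      using tau by (simp flip: mult.assoc)
    show ?thesis
      using nab(3)[of "fst p" "fst q" "fst r"] A_skew[of "fst q" "fst r"]
        pseudo_metricD(2)[OF met, of "fst q" "S (fst p)"]
      by (simp add: extended_metric_def ext_nab_def lin square algebra_simps)
  qed
qed

text \<open>
  The Ricci tensor is a trace over the first argument of the curvature, so only two diagonal
  entries matter: the component in the ideal for \<open>u\<close> in the ideal, and the \<open>e\<^sub>0\<close>-component for \<open>e\<^sub>0\<close>
  itself. The summands are grouped by the blocks of the Ricci tensor to which they contribute.
\<close>

lemma curvature_extension_fst:
  "fst (curvature (semidirect_bracket br D) (extended_metric g \<tau>) (u, 0) (v, s) (w, t)) =
    curvature br g u v w + ((\<tau> * g (S u) w) *\<^sub>R S v - (\<tau> * g (S v) w) *\<^sub>R S u) +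
    t *\<^sub>R (nab v (S u) - nab u (S v) + S (br u v)) +
    s *\<^sub>R (nab u (A w) - A (nab u w) + nab (D u) w) +
    (s * t) *\<^sub>R (A (S u) - S (D u))"
  unfolding curvature_def levi_civita_extension Let_def
  by (simp add: ext_nab_def semidirect_bracket_def lin algebra_simps)

lemma curvature_extension_snd:
  "snd (curvature (semidirect_bracket br D) (extended_metric g \<tau>) (0, 1) (v, s) (w, t)) =
    - \<tau> * g (S v) (A w) - \<tau> * g (S (D v)) w"
  unfolding curvature_def levi_civita_extension Let_def
  by (simp add: ext_nab_def semidirect_bracket_def lin algebra_simps)

abbreviation \<theta> where "\<theta> v \<equiv> lin_trace (br v \<circ> Dt)"

lemma linear_Dt_simps: "Dt (x + y) = Dt x + Dt y" "Dt (c *\<^sub>R x) = c *\<^sub>R Dt x"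
  by (simp_all add: linear_add[OF Dt(2)] linear_scale[OF Dt(2)])

lemma linear_maps:
  "linear (br v)" "linear (nab v)" "linear (\<lambda>u. nab u v)"
  "linear (\<lambda>u. S (br v u))" "linear (\<lambda>u. A (br v u))" "linear (\<lambda>u. D (br v u))"
  "linear (\<lambda>u. Dt (br v u))" "linear (\<lambda>u. S (br u v))" "linear (\<lambda>u. br v (D u))"
  "linear (\<lambda>u. nab v (S u))" "linear (\<lambda>u. nab v (A u))" "linear (\<lambda>u. A (nab v u))"
  "linear (\<lambda>u. A (nab u v))" "linear (\<lambda>u. nab (D u) v)"
  "linear (\<lambda>u. S (S u))" "linear (\<lambda>u. A (S u))" "linear (\<lambda>u. S (A u))" "linear (\<lambda>u. S (D u))"
  by (auto intro!: linearI simp: lin linear_Dt_simps)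

lemma nab_swap: "nab u v = nab v u - br v u"
  using nab(2)[of v u] by (simp add: algebra_simps)

lemma trace_ad: "lin_trace (br v) = 0"
  using nilpotent_trace_zero[OF fin nil, of "\<lambda>x. x" v] by (simp add: linear_iff)

lemma trace_D_ad: "lin_trace (\<lambda>u. D (br v u)) = 0"
  by (rule nilpotent_trace_zero[OF fin nil linear_D derivation_preserves_lower_central[OF der]])

text \<open>
  As \<open>S\<close> is half of \<open>D + D\<^sup>*\<close> and \<open>D \<circ> ad v\<close> has trace zero, only the adjoint contributes.
\<close>

lemma trace_S_ad: "lin_trace (\<lambda>u. S (br v u)) = \<theta> v / 2"
proof -
  have "lin_trace (\<lambda>u. Dt (br v u)) = \<theta> v"
    using lin_trace_commute[OF fin fin linear_maps(1) Dt(2)] by (simp add: o_def)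
  then have "lin_trace (\<lambda>u. D (br v u) + Dt (br v u)) = \<theta> v"
    by (simp add: lin_trace_add[OF fin linear_maps(6,7)] trace_D_ad)
  then show ?thesis
    by (simp add: sym_part_def lin_trace_scale[OF fin linear_compose_add[OF linear_maps(6,7)]])
qed

lemma trace_A_ad: "lin_trace (\<lambda>u. A (br v u)) = - \<theta> v / 2"
  using lin_trace_add[OF fin linear_maps(4,5), of v v] trace_D_ad[of v] trace_S_ad[of v]
  by (simp flip: D_split)

text \<open>
  Exchanging the arguments by torsion-freeness gives \<open>\<nabla>\<^sub>v - ad v\<close>, a skew map minus one that
  lowers the lower central series.
\<close>

lemma trace_nab_right: "lin_trace (\<lambda>u. nab u v) = 0"
proof -
  have "lin_trace (nab v) = 0"
    by (rule lin_trace_skew_zero[OF fin met linear_maps(2)]) (rule nab(3))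
  then have "lin_trace (\<lambda>u. nab v u - br v u) = 0"
    by (simp add: lin_trace_diff[OF fin linear_maps(2,1)] trace_ad)
  then show ?thesis by (simp flip: nab_swap)
qed

lemma trace_nab_S: "lin_trace (\<lambda>u. nab v (S u)) = 0"
  by (rule lin_trace_skew_symmetric_zero[OF fin met linear_maps(2) _ linear_S])
    (rule nab(3), rule S_symmetric)

lemma trace_mixed_right:
  "lin_trace (\<lambda>u. nab v (S u) - nab u (S v) + S (br u v)) = - \<theta> v / 2"
proof -
  have "lin_trace (\<lambda>u. S (br u v)) = lin_trace (\<lambda>u. - S (br v u))"
    by (rule arg_cong[of _ _ lin_trace]) (simp add: fun_eq_iff bracket(2)[of v] lin)
  also have "\<dots> = - \<theta> v / 2"
    by (simp add: lin_trace_minus[OF fin linear_maps(4)] trace_S_ad)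
  finally show ?thesis
    by (simp add: lin_trace_add[OF fin linear_compose_sub[OF linear_maps(10,3)] linear_maps(8)]
        lin_trace_diff[OF fin linear_maps(10,3)] trace_nab_S trace_nab_right)
qed

text \<open>
  The trace for \<open>ric(e\<^sub>0, w)\<close>, as \<open>trace_mixed_right\<close> is the one for \<open>ric(v, e\<^sub>0)\<close>.
  Torsion-freeness brings every product into the form \<open>\<nabla>\<^sub>w\<close>, and the two traces of \<open>\<nabla>\<^sub>w \<circ> A\<close> cancel.
\<close>

lemma trace_mixed_left:
  "lin_trace (\<lambda>u. nab u (A w) - A (nab u w) + nab (D u) w) = - \<theta> w / 2"
proof -
  have "lin_trace (\<lambda>u. A (nab u w)) = lin_trace (\<lambda>u. A (nab w u) - A (br w u))"
    by (rule arg_cong[of _ _ lin_trace]) (simp add: fun_eq_iff nab_swap[of _ w] lin)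
  also have "\<dots> = lin_trace (\<lambda>u. A (nab w u)) + \<theta> w / 2"
    by (simp add: lin_trace_diff[OF fin linear_maps(12,5)] trace_A_ad)
  also have "lin_trace (\<lambda>u. A (nab w u)) = lin_trace (\<lambda>u. nab w (A u))"
    by (rule lin_trace_commute[OF fin fin linear_maps(2) linear_A])
  finally have 1: "lin_trace (\<lambda>u. A (nab u w)) = lin_trace (\<lambda>u. nab w (A u)) + \<theta> w / 2" .
  have "lin_trace (\<lambda>u. nab (D u) w) = lin_trace (\<lambda>u. nab w (S u) + nab w (A u) - br w (D u))"
    by (rule arg_cong[of _ _ lin_trace]) (simp add: fun_eq_iff nab_swap[of _ w] D_split lin)
  also have "\<dots> = lin_trace (\<lambda>u. nab w (A u)) - lin_trace (\<lambda>u. br w (D u))"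
    by (simp add: lin_trace_diff[OF fin linear_compose_add[OF linear_maps(10,11)] linear_maps(9)]
        lin_trace_add[OF fin linear_maps(10,11)] trace_nab_S)
  also have "lin_trace (\<lambda>u. br w (D u)) = 0"
    using lin_trace_commute[OF fin fin linear_D linear_maps(1)] trace_D_ad by simp
  finally have 2: "lin_trace (\<lambda>u. nab (D u) w) = lin_trace (\<lambda>u. nab w (A u))" by simp
  show ?thesis
    by (simp add: lin_trace_add[OF fin linear_compose_sub[OF linear_maps(3,13)] linear_maps(14)]
        lin_trace_diff[OF fin linear_maps(3,13)] trace_nab_right 1 2)
qed

lemma trace_square: "lin_trace (\<lambda>u. A (S u) - S (D u)) = - lin_trace (S \<circ> S)"
proof -
  have "lin_trace (\<lambda>u. S (D u)) = lin_trace (\<lambda>u. S (S u) + S (A u))"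
    by (rule arg_cong[of _ _ lin_trace]) (simp add: fun_eq_iff D_split lin)
  also have "\<dots> = lin_trace (\<lambda>u. S (S u)) + lin_trace (\<lambda>u. S (A u))"
    by (rule lin_trace_add[OF fin linear_maps(15,17)])
  also have "lin_trace (\<lambda>u. S (A u)) = lin_trace (\<lambda>u. A (S u))"
    by (rule lin_trace_commute[OF fin fin linear_A linear_S])
  finally show ?thesis
    by (simp add: lin_trace_diff[OF fin linear_maps(16,18)] o_def)
qed

text \<open>
  The component of the curvature along \<open>e\<^sub>0\<close> adds \<open>- \<tau> g (S v) (A w) - \<tau> g (S (D v)) w\<close> to the trace
  over the ideal. This cancels the term \<open>\<tau> g (S (S v)) w\<close> coming from the rank-one part and leaves
  \<open>\<tau> g ((A \<circ> S - S \<circ> A) v) w\<close>, where \<open>A \<circ> S - S \<circ> A\<close> is half the commutator of \<open>D\<close> and its adjoint.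
\<close>

lemma ricci_extension:
  "ricci (semidirect_bracket br D) (extended_metric g \<tau>) (v, s) (w, t) =
    ricci br g v w + \<tau> * g ((1/2) *\<^sub>R (D (Dt v) - Dt (D v)) - lin_trace D *\<^sub>R S v) w
    - (t * \<theta> v + s * \<theta> w) / 2 - s * t * lin_trace (S \<circ> S)"
proof -
  let ?R = "\<lambda>p. curvature (semidirect_bracket br D) (extended_metric g \<tau>) p (v, s) (w, t)"
  have R: "linear ?R"
    unfolding curvature_def levi_civita_extension Let_def
    by (rule linearI) (simp_all add: ext_nab_def semidirect_bracket_def lin algebra_simps)
  have f: "linear (\<lambda>u. \<tau> * g (S u) w)"
    by (rule linearI) (simp_all add: lin algebra_simps)
  have f1: "linear (\<lambda>u. curvature br g u v w)"
    unfolding curvature_def Let_def by (rule linearI) (simp_all add: lin algebra_simps)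
  have f2: "linear (\<lambda>u. (\<tau> * g (S u) w) *\<^sub>R S v)" "linear (\<lambda>u. (\<tau> * g (S v) w) *\<^sub>R S u)"
    by (rule linearI; simp add: lin algebra_simps)+
  have f3: "linear (\<lambda>u. nab v (S u) - nab u (S v) + S (br u v))"
    by (intro linear_compose_add linear_compose_sub linear_maps)
  have f4: "linear (\<lambda>u. nab u (A w) - A (nab u w) + nab (D u) w)"
    by (intro linear_compose_add linear_compose_sub linear_maps)
  have f5: "linear (\<lambda>u. A (S u) - S (D u))"
    by (intro linear_compose_sub linear_maps)
  note l2 = linear_compose_sub[OF f2]
  note l3 = linear_compose_scale_right[OF f3, of t]
  note l4 = linear_compose_scale_right[OF f4, of s]
  note l5 = linear_compose_scale_right[OF f5, of "s * t"]
  note s2 = linear_compose_add[OF f1 l2]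
  note s3 = linear_compose_add[OF s2 l3]
  note s4 = linear_compose_add[OF s3 l4]
  have first: "lin_trace (\<lambda>u. fst (?R (u, 0))) =
      ricci br g v w + (\<tau> * g (S (S v)) w - \<tau> * g (S v) w * lin_trace D)
      - t * \<theta> v / 2 - s * \<theta> w / 2 - s * t * lin_trace (S \<circ> S)"
    unfolding curvature_extension_fst lin_trace_add[OF fin s4 l5] lin_trace_add[OF fin s3 l4]
      lin_trace_add[OF fin s2 l3] lin_trace_add[OF fin f1 l2] lin_trace_diff[OF fin f2]
      lin_trace_scale[OF fin f3] lin_trace_scale[OF fin f4] lin_trace_scale[OF fin f5]
      lin_trace_scale[OF fin linear_S] lin_trace_rank_one[OF fin f]
      trace_mixed_right trace_mixed_left trace_square trace_S ricci_def
    by simp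
  have "g (A (S v)) w = - g (S v) (A w)" by (rule A_skew)
  moreover have "g ((1/2) *\<^sub>R (D (Dt v) - Dt (D v))) w = g (A (S v)) w - g (S (A v)) w"
    by (simp only: commutator_A_S[symmetric] lin)
  moreover have "g (S (D v)) w = g (S (S v)) w + g (S (A v)) w"
    by (simp add: D_split lin)
  ultimately show ?thesis
    unfolding ricci_def[of "semidirect_bracket br D"] lin_trace_prod_real[OF fin R] first
      curvature_extension_snd
    by (simp only: lin) (simp add: field_simps)
qed

lemma ricci_eq_operator: "ricci br g v w = g (ricci_operator br g v) w"
  using iffD1[OF ricci_operator_eq_iff[OF fin met bracket] refl] by blast

text \<open>
  Comparing blocks: the pair \<open>(e\<^sub>0, e\<^sub>0)\<close> fixes the constant, the pairs \<open>(v, e\<^sub>0)\<close> give the trace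
  condition, and the pairs in the ideal give the Ricci operator.
\<close>

lemma einstein_extension_iff:
  "(\<forall>p q. ricci (semidirect_bracket br D) (extended_metric g \<tau>) p q = l * extended_metric g \<tau> p q)
    \<longleftrightarrow> l = - \<tau> * lin_trace (S \<circ> S) \<and>
      ricci_operator br g =
        (\<lambda>v. \<tau> *\<^sub>R (- lin_trace (S \<circ> S) *\<^sub>R v - (1/2) *\<^sub>R (D (Dt v) - Dt (D v))
                    + lin_trace D *\<^sub>R S v)) \<and>
      (\<forall>v. \<theta> v = 0)"
  (is "?E \<longleftrightarrow> ?l \<and> ricci_operator br g = ?F \<and> ?T")
proof -
  have F: "ricci br g v w = g (?F v) w \<longleftrightarrow>
    ricci br g v w + \<tau> * g ((1/2) *\<^sub>R (D (Dt v) - Dt (D v)) - lin_trace D *\<^sub>R S v) w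
      = - \<tau> * lin_trace (S \<circ> S) * g v w" for v w
    by (auto simp: lin algebra_simps)
  note Ric = ricci_operator_eq_iff[OF fin met bracket, of ?F]
  have zero: "ricci br g v 0 = 0" for v
    by (simp add: ricci_eq_operator lin)
  show ?thesis
  proof
    assume E: ?E
    have theta: "\<theta> v = 0" for v
      using E[rule_format, of "(v, 0)" "(0, 1)"]
      unfolding ricci_extension by (simp add: extended_metric_def lin zero)
    have "- lin_trace (S \<circ> S) = l * \<tau>"
      using E[rule_format, of "(0, 1)" "(0, 1)"] theta[of 0]
      unfolding ricci_extension by (simp add: extended_metric_def lin zero)
    then have l: ?l
      using tau by (metis mult.assoc mult.commute mult.right_neutral mult_minus_left mult_minus_right)
    have "ricci br g v w = g (?F v) w" for v w
      using E[rule_format, of "(v, 0)" "(w, 0)"]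
      unfolding F ricci_extension l by (simp add: extended_metric_def)
    then show "?l \<and> ricci_operator br g = ?F \<and> ?T"
      using l theta Ric by blast
  next
    assume *: "?l \<and> ricci_operator br g = ?F \<and> ?T"
    then have R: "ricci br g v w + \<tau> * g ((1/2) *\<^sub>R (D (Dt v) - Dt (D v)) - lin_trace D *\<^sub>R S v) w
      = l * g v w" for v w
      using Ric F by simp
    have theta: "\<theta> v = 0" for v
      using * by blast
    show ?E
    proof (intro allI)
      fix p q :: "'a \<times> real"
      obtain v s w t where pq: "p = (v, s)" "q = (w, t)" by fastforce
      have "l * (\<tau> * (s * t)) = - (\<tau> * \<tau>) * (s * t * lin_trace (S \<circ> S))"
        using * by (simp only: mult_minus_left mult_minus_right mult_ac)
      also have "\<dots> = - (s * t * lin_trace (S \<circ> S))"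
        unfolding tau by simp
      finally show "ricci (semidirect_bracket br D) (extended_metric g \<tau>) p q
          = l * extended_metric g \<tau> p q"
        unfolding pq ricci_extension R theta by (simp add: extended_metric_def distrib_left)
    qed
  qed
qed

end

theorem proposition2p1:
  fixes br :: "'a::real_vector \<Rightarrow> 'a \<Rightarrow> 'a"
    and g :: "'a \<Rightarrow> 'a \<Rightarrow> real"
    and D :: "'a \<Rightarrow> 'a"
    and \<tau> :: real
  assumes "finite_dim TYPE('a)"
    and "nilpotent_lie_algebra br"
    and "pseudo_metric g"
    and "derivation br D"
    and "\<tau> = 1 \<or> \<tau> = -1"
  shows "(einstein (semidirect_bracket br D) (extended_metric g \<tau>) \<longleftrightarrow>
            ricci_operator br g =
              (\<lambda>v. \<tau> *\<^sub>R (- lin_trace (sym_part g D \<circ> sym_part g D) *\<^sub>R v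
                          - (1/2) *\<^sub>R (D (metric_adjoint g D v) - metric_adjoint g D (D v))
                          + lin_trace D *\<^sub>R sym_part g D v)) \<and>
            (\<forall>v. lin_trace (br v \<circ> metric_adjoint g D) = 0)) \<and>
         (einstein (semidirect_bracket br D) (extended_metric g \<tau>) \<longrightarrow>
            (\<forall>p q. ricci (semidirect_bracket br D) (extended_metric g \<tau>) p q =
              - \<tau> * lin_trace (sym_part g D \<circ> sym_part g D) * extended_metric g \<tau> p q))"
proof -
  interpret derivation_extension br g D \<tau>
  proof (rule derivation_extension.intro)
    show "\<tau> * \<tau> = 1" using assms(5) by auto
  qed (rule assms)+
  let ?E = "\<lambda>l. \<forall>p q. ricci (semidirect_bracket br D) (extended_metric g \<tau>) p q
    = l * extended_metric g \<tau> p q"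
  have "einstein (semidirect_bracket br D) (extended_metric g \<tau>) \<longleftrightarrow>
      ?E (- \<tau> * lin_trace (S \<circ> S))"
    unfolding einstein_def by (metis einstein_extension_iff)
  then show ?thesis
    by (simp only: einstein_extension_iff simp_thms)
qed

end
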